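(* Let $q$ be a prime power, let $d \geq k \geq 4$ be fixed integers, and let $n$ be sufficiently large. Suppose $\mathcal{V}$ is a family of $k$-dimensional subspaces of $\mathbb{F}_q^n$ with no non-trivial intersecting subfamily of size $d+1$. Then \[|\mathcal{V}| \leq q^{n-k}\genfrac{[}{]}{0pt}{}{n-1}{k-1} = \genfrac{[}{]}{0pt}{}{n}{k} - \genfrac{[}{]}{0pt}{}{n-1}{k}.\]
   Context: $\genfrac{[}{]}{0pt}{}{n}{k} = \prod_{0 \leq i \leq k-1}\frac{q^{n-i}-1}{q^{k-i}-1}$. A family of subspaces is intersecting if any two distinct members have intersection of positive dimension; it is non-trivial intersecting if it is intersecting and the intersection of all its members is the zero subspace. *)

theory Defs
  imports Complex_Main "HOL-Library.Function_Algebras" "HOL-Number_Theory.Prime_Powers"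
begin

definition coord_scale :: "'a::field \<Rightarrow> (nat \<Rightarrow> 'a) \<Rightarrow> (nat \<Rightarrow> 'a)" where
  "coord_scale c v = (\<lambda>i. c * v i)"

global_interpretation coord: vector_space "coord_scale :: 'a::field \<Rightarrow> (nat \<Rightarrow> 'a) \<Rightarrow> (nat \<Rightarrow> 'a)"
  by unfold_locales (auto simp: coord_scale_def fun_eq_iff algebra_simps)

text \<open>The space of vectors of length \<open>n\<close> is realised inside the sequence space
  \<open>nat \<Rightarrow> 'a\<close>: the entries are those at the positions \<open>0, \<dots>, n - 1\<close>, and all later ones are
  zero. This makes \<open>n\<close> a term, so that it can be quantified after \<open>q\<close>, \<open>d\<close> and \<open>k\<close>.\<close>

definition coord_space :: "nat \<Rightarrow> (nat \<Rightarrow> 'a::field) set" where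
  "coord_space n = {v. \<forall>i\<ge>n. v i = 0}"

definition subspaces_of_dim :: "nat \<Rightarrow> nat \<Rightarrow> (nat \<Rightarrow> 'a::field) set set" where
  "subspaces_of_dim n k = {U. U \<subseteq> coord_space n \<and> coord.subspace U \<and> coord.dim U = k}"

definition intersecting :: "(nat \<Rightarrow> 'a::field) set set \<Rightarrow> bool" where
  "intersecting \<F> \<longleftrightarrow> (\<forall>A\<in>\<F>. \<forall>B\<in>\<F>. A \<noteq> B \<longrightarrow> coord.dim (A \<inter> B) > 0)"

definition nontrivial_intersecting :: "(nat \<Rightarrow> 'a::field) set set \<Rightarrow> bool" where
  "nontrivial_intersecting \<F> \<longleftrightarrow> intersecting \<F> \<and> \<Inter>\<F> = {0}"

text \<open>The truncated subtraction \<open>n - i\<close> is harmless: if \<open>n < k\<close>, the factor for \<open>i = n\<close>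
  already makes the product zero.\<close>

definition gauss_binomial :: "nat \<Rightarrow> nat \<Rightarrow> nat \<Rightarrow> real" where
  "gauss_binomial q n k = (\<Prod>i<k. (real q ^ (n - i) - 1) / (real q ^ (k - i) - 1))"

end

theory Submission
  imports Defs
begin

text \<open>A dense family of \<open>k\<close>-spaces already contains a non-trivial intersecting subfamily of size
  \<open>d + 1\<close>, and \<open>[n, k] - [n - 1, k]\<close> is at least \<open>1 - q ^ -k \<ge> 15/16\<close> of \<open>[n, k]\<close>. First discard the
  members containing two vectors \<open>a, b\<close> that lie together in fewer than \<open>d - 1\<close> members; there are at
  most \<open>d q ^ 2n\<close> of them, which is negligible. In a random independent list \<open>a, D, b, C\<close>, with
  \<open>C\<close> and \<open>D\<close> of lengths \<open>k - 1\<close> and \<open>k - 2\<close>, each of the spans of \<open>b, C\<close>, of \<open>C, a\<close> and of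
  \<open>a, D, b\<close> is a uniformly distributed \<open>k\<close>-space, so if more than two thirds of all \<open>k\<close>-spaces
  survive, some list has all three spans among the survivors. These three have zero intersection
  and pairwise meet, and adding \<open>d - 2\<close> further members through \<open>a\<close> and \<open>b\<close> keeps the family
  intersecting, as these meet the first two spans in \<open>b\<close> and \<open>a\<close>.\<close>

section \<open>Spans, independent lists and their numbers over a finite field\<close>

context vector_space
begin

text \<open>Coordinates with respect to \<open>X\<close> are unique, so a vector in both spans has
  its support in \<open>A\<close> and in \<open>B\<close>.\<close>

lemma span_Int_independent:
  assumes "independent X" "A \<subseteq> X" "B \<subseteq> X"
  shows "span A \<inter> span B = span (A \<inter> B)"
proof
  show "span (A \<inter> B) \<subseteq> span A \<inter> span B"
    by (simp add: span_mono)
  show "span A \<inter> span B \<subseteq> span (A \<inter> B)"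
  proof
    fix x assume x: "x \<in> span A \<inter> span B"
    then have xX: "x \<in> span X"
      using assms(2) span_mono by blast
    have rep: "representation X x = representation A x" "representation X x = representation B x"
      using x assms by (auto intro: representation_extend)
    have "v \<in> A \<inter> B" if "representation X x v \<noteq> 0" for v
      using that representation_ne_zero[of A x v] representation_ne_zero[of B x v] by (simp add: rep[symmetric])
    then have "(\<Sum>v | representation X x v \<noteq> 0. representation X x v *s v) \<in> span (A \<inter> B)"
      by (intro span_sum span_scale span_base) blast
    then show "x \<in> span (A \<inter> B)"
      by (simp add: sum_nonzero_representation_eq[OF assms(1) xX])
  qed
qed

text \<open>Finiteness of \<open>S\<close> makes the basis finite, so that cardinality 0 means empty
  rather than the default value of \<open>card\<close> at an infinite set.\<close>

lemma dim_pos_if_nonzero: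
  assumes "finite S" "x \<in> S" "x \<noteq> 0"
  shows "dim S > 0"
proof (rule ccontr)
  assume "\<not> dim S > 0"
  obtain B where B: "B \<subseteq> S" "independent B" "S \<subseteq> span B" "card B = dim S"
    by (rule basis_exists)
  have "B = {}"
    using B(1,4) finite_subset[OF B(1) assms(1)] \<open>\<not> dim S > 0\<close> by simp
  then show False using B(3) assms by auto
qed

text \<open>Each new basis vector \<open>b\<close> multiplies the size by that of the field: the map
  (c, v) to c b + v is injective because two different coefficients would put \<open>b\<close> into
  the span of the others.\<close>

lemma card_span_independent:
  assumes "finite (UNIV :: 'a set)" "finite B" "independent B"
  shows "finite (span B) \<and> card (span B) = card (UNIV :: 'a set) ^ card B"
  using assms(2,3)
proof (induction B rule: finite_induct)
  case empty
  then show ?case by simp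
next
  case (insert b B)
  have ind: "independent B" "b \<notin> span B"
    using insert by (simp_all add: independent_insert)
  have "bij_betw (\<lambda>(c, v). c *s b + v) (UNIV \<times> span B) (span (insert b B))"
  proof (intro bij_betwI' ballI)
    fix p p' :: "'a \<times> 'b" assume "p \<in> UNIV \<times> span B" "p' \<in> UNIV \<times> span B"
    moreover obtain c v c' v' where p: "p = (c, v)" "p' = (c', v')"
      by (meson surj_pair)
    ultimately have v: "v \<in> span B" "v' \<in> span B" by auto
    have "c = c'" if eq: "c *s b + v = c' *s b + v'"
    proof (rule ccontr)
      assume "c \<noteq> c'"
      have "(c - c') *s b = v' - v"
        using eq by (simp add: scale_left_diff_distrib algebra_simps)
      then have "(c - c') *s b \<in> span B" using v by (simp add: span_diff)
      from span_scale[OF this, of "inverse (c - c')"] have "b \<in> span B"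
        using \<open>c \<noteq> c'\<close> by simp
      then show False using ind by blast
    qed
    then show "((case p of (c, v) \<Rightarrow> c *s b + v) = (case p' of (c, v) \<Rightarrow> c *s b + v)) = (p = p')"
      by (auto simp: p)
  next
    fix p :: "'a \<times> 'b" assume "p \<in> UNIV \<times> span B"
    then show "(case p of (c, v) \<Rightarrow> c *s b + v) \<in> span (insert b B)"
      by (auto simp: span_breakdown_eq intro!: exI[of _ "fst p"])
  next
    fix y assume "y \<in> span (insert b B)"
    then obtain c where "y - c *s b \<in> span B" by (auto simp: span_breakdown_eq)
    then show "\<exists>p\<in>UNIV \<times> span B. y = (case p of (c, v) \<Rightarrow> c *s b + v)"
      by (intro bexI[of _ "(c, y - c *s b)"]) auto
  qed
  then have "finite (span (insert b B))"
    "card (span (insert b B)) = card (UNIV :: 'a set) * card (span B)"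
    using insert.IH ind assms(1) 
    by (auto simp: bij_betw_finite[symmetric] bij_betw_same_card[symmetric] card_cartesian_product)
  then show ?case using insert ind by simp
qed

text \<open>Ordered lists are used because they can be counted one entry at a time, and because
  rotating them moves different blocks into the last positions.\<close>

definition indep_lists :: "'b set \<Rightarrow> nat \<Rightarrow> 'b list set" where
  "indep_lists S m = {xs. length xs = m \<and> distinct xs \<and> set xs \<subseteq> S \<and> independent (set xs)}"

lemma finite_indep_lists: "finite S \<Longrightarrow> finite (local.indep_lists S m)"
  by (rule finite_subset[OF _ finite_lists_length_eq[of S m]]) (auto simp: indep_lists_def)

lemma indep_lists_Suc:
  "local.indep_lists S (Suc m) = (\<lambda>(xs, x). x # xs) ` (SIGMA xs:local.indep_lists S m. S - span (set xs))"
  (is "?L = ?R")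
proof
  show "?L \<subseteq> ?R"
  proof
    fix ys assume ys: "ys \<in> ?L"
    then obtain x xs where "ys = x # xs" by (cases ys) (auto simp: indep_lists_def)
    then show "ys \<in> ?R" using ys
      by (intro image_eqI[of _ _ "(xs, x)"]) (auto simp: indep_lists_def independent_insert)
  qed
  show "?R \<subseteq> ?L"
    by (auto simp: indep_lists_def independent_insertI dest: span_base)
qed

text \<open>A list with \<open>k + i\<close> entries can be extended in front by any vector of
  \<open>S\<close> outside its span, which has \<open>q ^ (k + i)\<close> elements, where
  \<open>q\<close> is the size of the field. This number does not depend on the list, so the last
  \<open>k\<close> entries of a random longer list are uniformly distributed.\<close>

lemma card_indep_lists_drop:
  assumes fin: "finite (UNIV :: 'a set)" and S: "subspace S" "finite S"
    and card: "card S = card (UNIV :: 'a set) ^ n"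
  shows "card {xs \<in> local.indep_lists S (k + r). \<phi> (drop r xs)} =
    card {xs \<in> local.indep_lists S k. \<phi> xs} *
      (\<Prod>i<r. card (UNIV :: 'a set) ^ n - card (UNIV :: 'a set) ^ (k + i))"
proof (induction r)
  case 0
  then show ?case by simp
next
  case (Suc r)
  let ?q = "card (UNIV :: 'a set)"
  let ?A = "\<lambda>r. {xs \<in> local.indep_lists S (k + r). \<phi> (drop r xs)}"
  have "?A (Suc r) = (\<lambda>(xs, x). x # xs) ` (SIGMA xs:?A r. S - span (set xs))"
    by (auto simp: indep_lists_Suc)
  also have "card \<dots> = card (SIGMA xs:?A r. S - span (set xs))"
    by (intro card_image) (auto simp: inj_on_def)
  also have "\<dots> = (\<Sum>xs\<in>?A r. card (S - span (set xs)))"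
    using S finite_indep_lists by (intro card_SigmaI) auto
  also have "\<dots> = (\<Sum>xs\<in>?A r. ?q ^ n - ?q ^ (k + r))"
  proof (rule sum.cong[OF refl])
    fix xs assume "xs \<in> ?A r"
    then have xs: "length xs = k + r" "distinct xs" "set xs \<subseteq> S" "independent (set xs)"
      by (auto simp: indep_lists_def)
    then have "span (set xs) \<subseteq> S" using S(1) span_minimal by blast
    then show "card (S - span (set xs)) = ?q ^ n - ?q ^ (k + r)"
      using card_span_independent[OF fin _ xs(4)] xs card
      by (simp add: card_Diff_subset distinct_card)
  qed
  finally show ?case by (simp add: Suc.IH mult_ac)
qed

lemma card_indep_lists:
  assumes "finite (UNIV :: 'a set)" "subspace S" "finite S" "card S = card (UNIV :: 'a set) ^ n"
  shows "card (local.indep_lists S r) = (\<Prod>i<r. card (UNIV :: 'a set) ^ n - card (UNIV :: 'a set) ^ i)"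
proof -
  have "local.indep_lists S 0 = {[]}" by (auto simp: indep_lists_def independent_empty)
  then show ?thesis
    using card_indep_lists_drop[OF assms, of 0 r "\<lambda>_. True"] by simp
qed

lemma card_subspace:
  assumes "finite (UNIV :: 'a set)" "subspace U" "finite U"
  shows "card U = card (UNIV :: 'a set) ^ dim U"
proof -
  obtain B where B: "B \<subseteq> U" "independent B" "U \<subseteq> span B" "card B = dim U"
    by (rule basis_exists)
  then have "span B = U" using assms(2) span_minimal by blast
  then show ?thesis
    using card_span_independent[OF assms(1) _ B(2)] B(1,4) assms(3) finite_subset by metis
qed

lemma span_indep_list_eq_iff:
  assumes "finite (UNIV :: 'a set)" "subspace U" "finite U" "xs \<in> local.indep_lists S (dim U)" "U \<subseteq> S"
  shows "span (set xs) = U \<longleftrightarrow> xs \<in> local.indep_lists U (dim U)"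
proof
  assume "span (set xs) = U"
  then show "xs \<in> local.indep_lists U (dim U)"
    using assms(4) span_superset unfolding indep_lists_def by blast
next
  assume "xs \<in> local.indep_lists U (dim U)"
  then have xs: "length xs = dim U" "distinct xs" "set xs \<subseteq> U" "independent (set xs)"
    by (auto simp: indep_lists_def)
  show "span (set xs) = U"
  proof (rule card_subset_eq[OF assms(3)])
    show "span (set xs) \<subseteq> U" using xs(3) assms(2) by (rule span_minimal)
    show "card (span (set xs)) = card U"
      using card_span_independent[OF assms(1) _ xs(4)] xs card_subspace[OF assms(1-3)]
      by (simp add: distinct_card)
  qed
qed

text \<open>The lists spanning \<open>U\<close> are its ordered bases. Their number depends only on
  \<open>k\<close>, and different \<open>U\<close> have disjoint sets of them, so counting lists
  counts subspaces with a constant weight.\<close>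

lemma card_indep_lists_span_in:
  assumes fin: "finite (UNIV :: 'a set)" and S: "finite S"
    and \<U>: "\<And>U. U \<in> \<U> \<Longrightarrow> U \<subseteq> S \<and> subspace U \<and> dim U = k"
  shows "card {xs \<in> local.indep_lists S k. span (set xs) \<in> \<U>} =
    card \<U> * (\<Prod>i<k. card (UNIV :: 'a set) ^ k - card (UNIV :: 'a set) ^ i)"
proof -
  have "\<U> \<subseteq> Pow S" using \<U> by blast
  then have fin\<U>: "finite \<U>" using S by (metis finite_Pow_iff finite_subset)
  have finU: "finite U" if "U \<in> \<U>" for U using \<U>[OF that] S finite_subset by blast
  have eq: "span (set xs) = U \<longleftrightarrow> xs \<in> local.indep_lists U k" if "xs \<in> local.indep_lists S k" "U \<in> \<U>" for xs U
    using span_indep_list_eq_iff[OF fin _ finU] \<U> that by metis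
  have sub: "local.indep_lists U k \<subseteq> local.indep_lists S k" if "U \<in> \<U>" for U
    using \<U>[OF that] by (auto simp: indep_lists_def)
  have "{xs \<in> local.indep_lists S k. span (set xs) \<in> \<U>} = (\<Union>U\<in>\<U>. local.indep_lists U k)"
    using eq sub by blast
  moreover have "card (\<Union>U\<in>\<U>. local.indep_lists U k) = (\<Sum>U\<in>\<U>. card (local.indep_lists U k))"
  proof (rule card_UN_disjoint)
    show "\<forall>U\<in>\<U>. \<forall>W\<in>\<U>. U \<noteq> W \<longrightarrow> local.indep_lists U k \<inter> local.indep_lists W k = {}"
      using eq sub by blast
  qed (use fin\<U> finU finite_indep_lists in auto)
  moreover have "card (local.indep_lists U k) =
      (\<Prod>i<k. card (UNIV :: 'a set) ^ k - card (UNIV :: 'a set) ^ i)" if "U \<in> \<U>" for U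
    using card_indep_lists[OF fin _ finU[OF that]] card_subspace[OF fin _ finU[OF that]] \<U>[OF that]
    by metis
  ultimately show ?thesis by simp
qed

lemma card_indep_lists_rotate_le:
  assumes "finite S"
  shows "card {xs \<in> local.indep_lists S m. \<phi> (rotate j xs)} \<le> card {xs \<in> local.indep_lists S m. \<phi> xs}"
proof (rule card_inj_on_le)
  have "inj (rotate j :: 'b list \<Rightarrow> 'b list)"
    unfolding rotate_def by (rule inj_fn[OF inj_rotate1])
  then show "inj_on (rotate j) {xs \<in> local.indep_lists S m. \<phi> (rotate j xs)}"
    by (rule inj_on_subset) simp
  show "rotate j ` {xs \<in> local.indep_lists S m. \<phi> (rotate j xs)} \<subseteq> {xs \<in> local.indep_lists S m. \<phi> xs}"
    by (auto simp: indep_lists_def)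
qed (use assms finite_indep_lists in simp)

end

section \<open>The coordinate space and the number of its \<open>k\<close>-dimensional
  subspaces\<close>

lemma coord_space_subspace: "coord.subspace (coord_space n)"
  by (auto simp: coord.subspace_def coord_space_def coord_scale_def)

lemma card_coord_space:
  "finite (coord_space n :: (nat \<Rightarrow> 'a::{field,finite}) set) \<and>
   card (coord_space n :: (nat \<Rightarrow> 'a) set) = card (UNIV :: 'a set) ^ n"
proof -
  have "bij_betw (\<lambda>f. restrict f {..<n}) (coord_space n :: (nat \<Rightarrow> 'a) set) ({..<n} \<rightarrow>\<^sub>E UNIV)"
    by (rule bij_betw_byWitness[where f' = "\<lambda>f i. if i < n then f i else 0"])
      (auto simp: coord_space_def fun_eq_iff PiE_def extensional_def)
  then show ?thesis
    by (auto simp: bij_betw_finite bij_betw_same_card card_PiE finite_PiE)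
qed

lemma finite_subspaces_of_dim:
  "finite (subspaces_of_dim n k :: (nat \<Rightarrow> 'a::{field,finite}) set set)"
proof (rule finite_subset)
  show "(subspaces_of_dim n k :: (nat \<Rightarrow> 'a) set set) \<subseteq> Pow (coord_space n)"
    by (auto simp: subspaces_of_dim_def)
qed (simp add: card_coord_space)

text \<open>Independent lists of length \<open>k\<close> are counted twice: directly, and according
  to the subspace they span.\<close>

lemma card_subspaces_of_dim:
  assumes q: "card (UNIV :: 'a::{field,finite} set) = q" and "k \<le> n"
  shows "real (card (subspaces_of_dim n k :: (nat \<Rightarrow> 'a) set set)) = gauss_binomial q n k"
proof -
  have q2: "q \<ge> 2"
    using card_mono[of UNIV "{0, 1 :: 'a}"] q by simp
  let ?S = "coord_space n :: (nat \<Rightarrow> 'a) set"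
  have S: "finite ?S" "card ?S = card (UNIV :: 'a set) ^ n"
    by (simp_all add: card_coord_space)
  have "{xs \<in> coord.indep_lists ?S k. coord.span (set xs) \<in> subspaces_of_dim n k} = coord.indep_lists ?S k"
    by (auto simp: coord.indep_lists_def subspaces_of_dim_def coord.dim_eq_card_independent distinct_card
        dest: coord.span_minimal[OF _ coord_space_subspace])
  with coord.card_indep_lists_span_in[OF _ S(1), of "subspaces_of_dim n k" k]
    coord.card_indep_lists[OF _ coord_space_subspace S, of k]
  have "card (subspaces_of_dim n k :: (nat \<Rightarrow> 'a) set set) * (\<Prod>i<k. q ^ k - q ^ i) = (\<Prod>i<k. q ^ n - q ^ i)"
    by (simp add: subspaces_of_dim_def q)
  then have "real (card (subspaces_of_dim n k :: (nat \<Rightarrow> 'a) set set)) * real (\<Prod>i<k. q ^ k - q ^ i)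
      = real (\<Prod>i<k. q ^ n - q ^ i)"
    by (metis of_nat_mult)
  \<comment> \<open>Extracting \<open>q ^ i\<close> from each factor leaves the Gaussian numerator
    for \<open>m = n\<close> and the denominator for \<open>m = k\<close>; the extracted product is
    the same for both and cancels.\<close>
  moreover have factor: "real (\<Prod>i<k. q ^ m - q ^ i) = (\<Prod>i<k. real q ^ i) * (\<Prod>i<k. real q ^ (m - i) - 1)"
    if "k \<le> m" for m
    unfolding of_nat_prod prod.distrib[symmetric]
  proof (rule prod.cong[OF refl])
    fix i assume "i \<in> {..<k}"
    then have "i \<le> m" using that by simp
    then have "q ^ i \<le> q ^ m" using q2 by (auto intro: power_increasing)
    moreover have "real q ^ m = real q ^ i * real q ^ (m - i)"
      using \<open>i \<le> m\<close> by (simp flip: power_add)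
    ultimately show "real (q ^ m - q ^ i) = real q ^ i * (real q ^ (m - i) - 1)"
      by (simp add: of_nat_diff algebra_simps)
  qed
  moreover have "(\<Prod>i<k. real q ^ i) \<noteq> 0"
    using q2 by simp
  ultimately have "real (card (subspaces_of_dim n k :: (nat \<Rightarrow> 'a) set set)) * (\<Prod>i<k. real q ^ (k - i) - 1)
      = (\<Prod>i<k. real q ^ (n - i) - 1)"
    unfolding factor[OF \<open>k \<le> n\<close>] factor[OF order_refl] by (metis mult.left_commute mult_left_cancel)
  moreover have "(\<Prod>i<k. real q ^ (k - i) - 1) > 0"
    using q2 by (intro prod_pos) (auto intro: one_less_power)
  ultimately show ?thesis
    unfolding gauss_binomial_def prod_dividef by (metis less_irrefl nonzero_eq_divide_eq)
qed

section \<open>Identities and bounds for Gaussian binomials\<close>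

lemma gauss_binomial_Suc_Suc:
  "gauss_binomial q (Suc n) (Suc k) = (real q ^ Suc n - 1) / (real q ^ Suc k - 1) * gauss_binomial q n k"
  by (simp add: gauss_binomial_def prod.lessThan_Suc_shift del: prod.lessThan_Suc)

text \<open>Up to the common denominator, both sides are the product of the factors
  \<open>q ^ j - 1\<close> for \<open>j\<close> from \<open>n + 1 - k\<close> to
  \<open>n + 1\<close>.\<close>

lemma gauss_binomial_Suc_left:
  assumes "k \<le> n"
  shows "(real q ^ Suc n - 1) * gauss_binomial q n k = (real q ^ (Suc n - k) - 1) * gauss_binomial q (Suc n) k"
proof -
  have "(real q ^ Suc n - 1) * (\<Prod>i<k. real q ^ (n - i) - 1)
      = (real q ^ (Suc n - k) - 1) * (\<Prod>i<k. real q ^ (Suc n - i) - 1)"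
    using assms by (induction k) (simp_all add: mult_ac Suc_diff_le)
  then show ?thesis
    by (simp add: gauss_binomial_def prod_dividef)
qed

text \<open>After multiplication by \<open>q ^ n - 1\<close> both lower coefficients become
  multiples of \<open>G\<close>, and what remains is
  \<open>q ^ (n - k) * (q ^ k - 1) = (q ^ n - 1) - (q ^ (n - k) - 1)\<close>.\<close>

lemma gauss_binomial_pascal:
  assumes "q \<ge> 2" "1 \<le> k" "k < n"
  shows "real q ^ (n - k) * gauss_binomial q (n - 1) (k - 1) = gauss_binomial q n k - gauss_binomial q (n - 1) k"
proof -
  obtain m j where mj: "n = Suc m" "k = Suc j"
    using assms by (metis Suc_le_D One_nat_def less_imp_Suc_add)
  define G where "G = gauss_binomial q n k"
  have "real q ^ m > 1" if "m > 0" for m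
    using assms that by (intro one_less_power) auto
  from this[of n] this[of k] assms have nz: "real q ^ n - 1 \<noteq> 0" "real q ^ k - 1 \<noteq> 0"
    by linarith+
  have 1: "(real q ^ n - 1) * gauss_binomial q (n - 1) (k - 1) = (real q ^ k - 1) * G"
    using gauss_binomial_Suc_Suc[of q m j] nz mj by (simp add: G_def)
  have 2: "(real q ^ n - 1) * gauss_binomial q (n - 1) k = (real q ^ (n - k) - 1) * G"
    using gauss_binomial_Suc_left[of k m q] assms mj by (simp add: G_def)
  have e: "real q ^ n = real q ^ (n - k) * real q ^ k"
    using assms by (simp flip: power_add)
  have "(real q ^ n - 1) * (real q ^ (n - k) * gauss_binomial q (n - 1) (k - 1))
     = real q ^ (n - k) * ((real q ^ k - 1) * G)"
    by (simp only: 1 mult.left_commute[of "real q ^ n - 1"])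
  also have "\<dots> = (real q ^ n - 1) * G - (real q ^ (n - k) - 1) * G"
    by (simp add: e algebra_simps)
  also have "\<dots> = (real q ^ n - 1) * (G - gauss_binomial q (n - 1) k)"
    by (simp only: 2 right_diff_distrib)
  finally have "(real q ^ n - 1) * (real q ^ (n - k) * gauss_binomial q (n - 1) (k - 1))
     = (real q ^ n - 1) * (G - gauss_binomial q (n - 1) k)" .
  then show ?thesis using nz by (simp add: G_def)
qed

text \<open>The ratio of the two coefficients is \<open>(q ^ (n - k) - 1) / (q ^ n - 1)\<close>,
  which is at most \<open>1 / q ^ k\<close>.\<close>

lemma gauss_binomial_pred_left_le:
  assumes "q \<ge> 2" "1 \<le> k" "k < n"
  shows "real q ^ k * gauss_binomial q (n - 1) k \<le> gauss_binomial q n k"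
proof -
  obtain m where m: "n = Suc m" using assms by (metis less_imp_Suc_add)
  have pos: "gauss_binomial q n k \<ge> 0"
    using assms by (auto simp: gauss_binomial_def intro!: prod_nonneg divide_nonneg_nonneg)
  have nz: "real q ^ n - 1 > 0"
    using assms by (auto intro: one_less_power)
  have e: "real q ^ n = real q ^ (n - k) * real q ^ k"
    using assms by (simp flip: power_add)
  have "(real q ^ n - 1) * (real q ^ k * gauss_binomial q (n - 1) k)
     = (real q ^ k * (real q ^ (n - k) - 1)) * gauss_binomial q n k"
    using gauss_binomial_Suc_left[of k m q] assms m by simp
  also have "\<dots> \<le> (real q ^ n - 1) * gauss_binomial q n k"
    using assms pos by (intro mult_right_mono) (auto simp: e algebra_simps)
  finally show ?thesis using nz by simp
qed

text \<open>Each of the \<open>k\<close> factors is at least \<open>q ^ (n - k)\<close>.\<close>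

lemma gauss_binomial_ge_power:
  assumes "q \<ge> 2" "k \<le> n"
  shows "real q ^ (k * (n - k)) \<le> gauss_binomial q n k"
proof -
  have "(\<Prod>i<k. real q ^ (n - k)) \<le> gauss_binomial q n k"
    unfolding gauss_binomial_def
  proof (rule prod_mono)
    fix i assume "i \<in> {..<k}"
    then have i: "real q ^ (k - i) > 1" "n - i = (n - k) + (k - i)"
      using assms by (auto intro: one_less_power)
    have "real q ^ (n - k) * (real q ^ (k - i) - 1) \<le> real q ^ (n - i) - 1"
      unfolding i(2) power_add using assms by (simp add: algebra_simps)
    then show "0 \<le> real q ^ (n - k) \<and> real q ^ (n - k) \<le> (real q ^ (n - i) - 1) / (real q ^ (k - i) - 1)"
      using i(1) by (simp add: field_simps)
  qed
  then show ?thesis by (simp add: power_mult[symmetric] mult.commute)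
qed

section \<open>Building a non-trivial intersecting family\<close>

lemma dim_Int_pos:
  fixes A B :: "(nat \<Rightarrow> 'a::{field,finite}) set"
  assumes "A \<subseteq> coord_space n" "x \<in> A" "x \<in> B" "x \<noteq> 0"
  shows "coord.dim (A \<inter> B) > 0"
  using assms card_coord_space finite_subset
  by (intro coord.dim_pos_if_nonzero[of _ x]) (auto intro: finite_subset[of _ "coord_space n"])

lemma nontrivial_intersecting_from_triple:
  fixes \<V> :: "(nat \<Rightarrow> 'a::{field,finite}) set set"
  assumes \<V>: "\<V> \<subseteq> subspaces_of_dim n k" and mem: "P \<in> \<V>" "Q \<in> \<V>" "F \<in> \<V>"
    and "a \<in> P" "b \<notin> P" "b \<in> Q" "a \<notin> Q" "a \<in> F" "b \<in> F"
    and "c \<in> P" "c \<in> Q" "c \<noteq> 0" and PQF: "P \<inter> Q \<inter> F \<subseteq> {0}"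
    and deg: "d - 1 \<le> card {G \<in> \<V>. a \<in> G \<and> b \<in> G}" and "d \<ge> 2"
  shows "\<exists>\<W>\<subseteq>\<V>. card \<W> = d + 1 \<and> nontrivial_intersecting \<W>"
proof -
  have sub: "coord.subspace G" "G \<subseteq> coord_space n" if "G \<in> \<V>" for G
    using \<V> that by (auto simp: subspaces_of_dim_def)
  have "a \<noteq> 0" "b \<noteq> 0"
    using \<open>a \<notin> Q\<close> \<open>b \<notin> P\<close> sub mem coord.subspace_0 by blast+
  let ?\<D> = "{G \<in> \<V>. a \<in> G \<and> b \<in> G}"
  have fin: "finite ?\<D>"
    using \<V> finite_subspaces_of_dim by (metis (no_types, lifting) finite_subset mem_Collect_eq subsetI)
  \<comment> \<open>\<open>F\<close> itself is one of the members through \<open>a\<close> and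
    \<open>b\<close>, which costs one of the \<open>d - 1\<close>.\<close>
  have "d - 2 \<le> card (?\<D> - {F})"
    using deg fin mem \<open>a \<in> F\<close> \<open>b \<in> F\<close> by simp
  then obtain \<G> where \<G>: "\<G> \<subseteq> ?\<D> - {F}" "card \<G> = d - 2" "finite \<G>"
    by (rule obtain_subset_with_card_n)
  define \<W> where "\<W> = {P, Q, F} \<union> \<G>"
  have "P \<noteq> Q" "P \<noteq> F" "Q \<noteq> F" "P \<notin> \<G>" "Q \<notin> \<G>" "F \<notin> \<G>"
    using assms \<G> by auto
  then have "card \<W> = d + 1"
    using \<G> \<open>d \<ge> 2\<close> by (simp add: \<W>_def)
  moreover have "\<W> \<subseteq> \<V>" using mem \<G> by (auto simp: \<W>_def)
  moreover have "intersecting \<W>"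
    unfolding intersecting_def
  proof (intro ballI impI)
    fix A B assume AB: "A \<in> \<W>" "B \<in> \<W>" "A \<noteq> B"
    have ABV: "A \<subseteq> coord_space n" using AB \<open>\<W> \<subseteq> \<V>\<close> sub by blast
    \<comment> \<open>All members but \<open>P\<close> and \<open>Q\<close> contain both
      \<open>a\<close> and \<open>b\<close>. Hence two distinct members share \<open>a\<close> or
      \<open>b\<close>, except for the pair \<open>P\<close>, \<open>Q\<close>, which shares
      \<open>c\<close>.\<close>
    have "G \<in> ?\<D> \<or> G = P \<or> G = Q" if "G \<in> \<W>" for G
      using that \<G> assms by (auto simp: \<W>_def)
    from this[OF AB(1)] this[OF AB(2)] AB(3)
    have "\<exists>x. x \<noteq> 0 \<and> x \<in> A \<and> x \<in> B"
      using assms \<open>a \<noteq> 0\<close> \<open>b \<noteq> 0\<close> by auto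
    then show "coord.dim (A \<inter> B) > 0"
      using dim_Int_pos[OF ABV] by blast
  qed
  moreover have "\<Inter>\<W> = {0}"
  proof
    show "\<Inter>\<W> \<subseteq> {0}" using PQF by (auto simp: \<W>_def)
    show "{0} \<subseteq> \<Inter>\<W>" using sub coord.subspace_0 \<open>\<W> \<subseteq> \<V>\<close> by blast
  qed
  ultimately show ?thesis by (auto simp: nontrivial_intersecting_def)
qed

text \<open>The last \<open>k\<close> entries of the rotations of \<open>a, D, b, C\<close> by \<open>0\<close>, \<open>1\<close> and \<open>k\<close> are \<open>b, C\<close>, then
  \<open>C, a\<close>, then \<open>a, D, b\<close>.\<close>

lemma nontrivial_intersecting_from_list:
  fixes \<V> :: "(nat \<Rightarrow> 'a::{field,finite}) set set"
  assumes \<V>: "\<V> \<subseteq> subspaces_of_dim n k" and "k \<ge> 2" "d \<ge> 2"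
    and xs: "xs \<in> coord.indep_lists (coord_space n) (k + (k - 1))"
    and mem: "\<And>j. j \<in> {0, 1, k} \<Longrightarrow> coord.span (set (drop (k - 1) (rotate j xs))) \<in> \<V>"
    and deg: "\<And>a b. a \<in> coord.span (set (drop (k - 1) (rotate k xs))) \<Longrightarrow>
      b \<in> coord.span (set (drop (k - 1) (rotate k xs))) \<Longrightarrow> d - 1 \<le> card {G \<in> \<V>. a \<in> G \<and> b \<in> G}"
  shows "\<exists>\<W>\<subseteq>\<V>. card \<W> = d + 1 \<and> nontrivial_intersecting \<W>"
proof -
  have len: "length xs = 2 * k - 1" and ind: "distinct xs" "coord.independent (set xs)"
    using xs \<open>k \<ge> 2\<close> by (auto simp: coord.indep_lists_def)
  obtain a ys where ys: "xs = a # ys" "length ys = 2 * k - 2"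
    using len \<open>k \<ge> 2\<close> by (cases xs) auto
  obtain D zs where D: "ys = D @ zs" "length D = k - 2" "length zs = k"
    using ys \<open>k \<ge> 2\<close> by (intro that[of "take (k - 2) ys" "drop (k - 2) ys"]) auto
  obtain b C where C: "zs = b # C" "length C = k - 1"
    using D \<open>k \<ge> 2\<close> by (cases zs) auto
  obtain c where c: "c \<in> set C"
    using C \<open>k \<ge> 2\<close> by (cases C) auto
  have xs_eq: "xs = a # D @ b # C" using ys D C by simp
  \<comment> \<open>The cut falls exactly after \<open>k\<close> entries, so rotation by
    \<open>k\<close> swaps the two blocks.\<close>
  have "xs = (a # D @ [b]) @ C" "length (a # D @ [b]) = k"
    using xs_eq D \<open>k \<ge> 2\<close> by auto
  then have "rotate k xs = C @ a # D @ [b]"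
    by (metis rotate_append)
  then have d: "drop (k - 1) (rotate 0 xs) = b # C" "drop (k - 1) (rotate 1 xs) = C @ [a]"
    "drop (k - 1) (rotate k xs) = a # D @ [b]"
    using C D \<open>k \<ge> 2\<close> by (auto simp: xs_eq drop_Cons' )
  define P Q F where "P = coord.span (set (C @ [a]))" and "Q = coord.span (set (b # C))"
    and "F = coord.span (set (a # D @ [b]))"
  have notin: "x \<notin> coord.span Y" if "x \<in> set xs" "Y \<subseteq> set xs - {x}" for x Y
    using ind(2) that coord.span_mono[OF that(2)] by (auto simp: coord.dependent_def)
  \<comment> \<open>Being outside the span of the empty set is how \<open>c\<close> is seen to be
    nonzero.\<close>
  have notin': "a \<notin> Q" "b \<notin> P" "c \<notin> coord.span {}"
    unfolding P_def Q_def using ind(1) c by (intro notin; auto simp: xs_eq)+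
  have "P \<inter> Q = coord.span (set C)"
  proof -
    have "P \<inter> Q = coord.span (set (C @ [a]) \<inter> set (b # C))"
      unfolding P_def Q_def by (rule coord.span_Int_independent[OF ind(2)]) (auto simp: xs_eq)
    also have "set (C @ [a]) \<inter> set (b # C) = set C"
      using ind(1) by (auto simp: xs_eq)
    finally show ?thesis .
  qed
  moreover have "coord.span (set C) \<inter> F = coord.span (set C \<inter> set (a # D @ [b]))"
    unfolding F_def by (rule coord.span_Int_independent[OF ind(2)]) (auto simp: xs_eq)
  moreover have "set C \<inter> set (a # D @ [b]) = {}"
    using ind(1) by (auto simp: xs_eq)
  ultimately have PQF: "P \<inter> Q \<inter> F \<subseteq> {0}" by simp
  have PQF_mem: "P \<in> \<V>" "Q \<in> \<V>" "F \<in> \<V>"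
    using mem[of 0] mem[of 1] mem[of k] d by (simp_all add: P_def Q_def F_def)
  have ab: "a \<in> F" "b \<in> F" "a \<in> P" "b \<in> Q" "c \<in> P" "c \<in> Q"
    using c by (auto simp: F_def P_def Q_def intro: coord.span_base)
  have "d - 1 \<le> card {G \<in> \<V>. a \<in> G \<and> b \<in> G}"
    using deg[of a b] ab d by (simp add: F_def)
  moreover have "c \<noteq> 0" using notin' by auto
  ultimately show ?thesis
    using nontrivial_intersecting_from_triple[OF \<V> PQF_mem] ab notin' PQF \<open>d \<ge> 2\<close> by blast
qed

section \<open>Averaging over lists and deletion of light members\<close>

text \<open>A union bound: rotation preserves the set of independent lists, so for each
  \<open>j\<close> the share of lists whose rotation by \<open>j\<close> ends in a basis of a space
  outside \<open>\<V>\<close> is at most the share of such spaces. By \<open>less\<close> these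
  shares sum to less than 1.\<close>

lemma exists_indep_list_rotations_in:
  fixes \<V> :: "(nat \<Rightarrow> 'a::{field,finite}) set set"
  assumes "k + r \<le> n" and \<V>: "\<V> \<subseteq> subspaces_of_dim n k" and J: "finite J"
    and less: "card J * card (subspaces_of_dim n k - \<V>) < card (subspaces_of_dim n k :: (nat \<Rightarrow> 'a) set set)"
  shows "\<exists>xs \<in> coord.indep_lists (coord_space n) (k + r).
    \<forall>j\<in>J. coord.span (set (drop r (rotate j xs))) \<in> \<V>"
proof (rule ccontr)
  assume neg: "\<not> ?thesis"
  let ?S = "coord_space n :: (nat \<Rightarrow> 'a) set"
  let ?Sub = "subspaces_of_dim n k :: (nat \<Rightarrow> 'a) set set"
  let ?L = "coord.indep_lists ?S"
  let ?q = "card (UNIV :: 'a set)"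
  \<comment> \<open>The number of lists whose last \<open>k\<close> entries span a given
    \<open>k\<close>-space: its ordered bases times the ways to prepend \<open>r\<close> vectors. It
    is positive because \<open>k + r \<le> n\<close>.\<close>
  define w where "w = (\<Prod>i<k. ?q ^ k - ?q ^ i) * (\<Prod>i<r. ?q ^ n - ?q ^ (k + i))"
  have "?q \<ge> 2"
    using card_mono[of UNIV "{0, 1 :: 'a}"] by simp
  then have "w > 0"
    using \<open>k + r \<le> n\<close> by (auto simp: w_def intro!: prod_pos power_strict_increasing)
  have S: "finite ?S" "card ?S = ?q ^ n"
    by (simp_all add: card_coord_space)
  have count: "card {xs \<in> ?L (k + r). coord.span (set (drop r xs)) \<in> \<U>} = card \<U> * w"
    if "\<U> \<subseteq> ?Sub" for \<U>
  proof -
    have "card {xs \<in> ?L k. coord.span (set xs) \<in> \<U>} = card \<U> * (\<Prod>i<k. ?q ^ k - ?q ^ i)"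
      using that by (intro coord.card_indep_lists_span_in S) (auto simp: subspaces_of_dim_def)
    then show ?thesis
      using coord.card_indep_lists_drop[OF _ coord_space_subspace S, of k r "\<lambda>xs. coord.span (set xs) \<in> \<U>"]
      by (simp add: w_def)
  qed
  have in_Sub: "coord.span (set (drop r xs)) \<in> ?Sub" if "xs \<in> ?L (k + r)" for xs
  proof -
    have "coord.independent (set (drop r xs))" "set (drop r xs) \<subseteq> ?S" "card (set (drop r xs)) = k"
      using that set_drop_subset[of r xs] coord.independent_mono[of "set xs" "set (drop r xs)"]
      by (auto simp: coord.indep_lists_def distinct_card)
    then show ?thesis
      using coord.span_minimal[OF _ coord_space_subspace]
      by (simp add: subspaces_of_dim_def coord.dim_eq_card_independent)
  qed
  let ?B = "\<lambda>j. {xs \<in> ?L (k + r). coord.span (set (drop r (rotate j xs))) \<in> ?Sub - \<V>}"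
  have rot: "rotate j xs \<in> ?L (k + r)" if "xs \<in> ?L (k + r)" for j xs
    using that by (simp add: coord.indep_lists_def)
  have finL: "finite (?L (k + r))"
    using S(1) by (rule coord.finite_indep_lists)
  have "?L (k + r) \<subseteq> (\<Union>j\<in>J. ?B j)"
    using neg in_Sub[OF rot] by blast
  then have "card (?L (k + r)) \<le> card (\<Union>j\<in>J. ?B j)"
    using J finL by (intro card_mono) (auto intro: finite_subset[OF _ finL])
  also have "\<dots> \<le> (\<Sum>j\<in>J. card (?B j))"
    using J by (rule card_UN_le)
  also have "\<dots> \<le> (\<Sum>j\<in>J. card (?Sub - \<V>) * w)"
    using coord.card_indep_lists_rotate_le[OF S(1), of "k + r" "\<lambda>xs. coord.span (set (drop r xs)) \<in> ?Sub - \<V>"]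
      count[of "?Sub - \<V>"] by (intro sum_mono) auto
  also have "\<dots> = card J * card (?Sub - \<V>) * w" by simp
  also have "\<dots> < card ?Sub * w" using less \<open>w > 0\<close> by simp
  also have "\<dots> = card {xs \<in> ?L (k + r). coord.span (set (drop r xs)) \<in> ?Sub}"
    by (rule count[symmetric]) simp
  also have "\<dots> \<le> card (?L (k + r))"
    using finL by (intro card_mono) auto
  finally show False by simp
qed

text \<open>Each such member lies among the fewer than \<open>m\<close> members through some ordered
  pair of vectors of \<open>S\<close>, and there are \<open>card S ^ 2\<close> pairs.\<close>

lemma card_light_members_le:
  assumes "finite S" "finite \<V>" "\<And>F. F \<in> \<V> \<Longrightarrow> F \<subseteq> S"
  shows "card {F \<in> \<V>. \<exists>a\<in>F. \<exists>b\<in>F. card {G \<in> \<V>. a \<in> G \<and> b \<in> G} < m} \<le> card S ^ 2 * m"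
proof -
  let ?D = "\<lambda>p. {G \<in> \<V>. fst p \<in> G \<and> snd p \<in> G}"
  let ?I = "{p \<in> S \<times> S. card (?D p) < m}"
  have "finite ?I" using assms(1) by simp
  have "{F \<in> \<V>. \<exists>a\<in>F. \<exists>b\<in>F. card {G \<in> \<V>. a \<in> G \<and> b \<in> G} < m} \<subseteq> (\<Union>p\<in>?I. ?D p)"
    using assms(3) by fastforce
  then have "card {F \<in> \<V>. \<exists>a\<in>F. \<exists>b\<in>F. card {G \<in> \<V>. a \<in> G \<and> b \<in> G} < m} \<le> card (\<Union>p\<in>?I. ?D p)"
    using \<open>finite ?I\<close> assms(2) by (intro card_mono) auto
  also have "\<dots> \<le> (\<Sum>p\<in>?I. card (?D p))"
    using \<open>finite ?I\<close> by (rule card_UN_le)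
  also have "\<dots> \<le> of_nat (card ?I) * m"
    by (rule sum_bounded_above) auto
  also have "\<dots> \<le> card (S \<times> S) * m"
    using card_mono[of "S \<times> S" ?I] assms(1) by auto
  finally show ?thesis by (simp add: card_cartesian_product power2_eq_square)
qed

lemma card_le_if_no_nontrivial_intersecting:
  fixes \<V> :: "(nat \<Rightarrow> 'a::{field,finite}) set set"
  assumes \<V>: "\<V> \<subseteq> subspaces_of_dim n k" and "k \<ge> 2" "d \<ge> 2" "2 * k - 1 \<le> n"
    and no: "\<not> (\<exists>\<W>\<subseteq>\<V>. card \<W> = d + 1 \<and> nontrivial_intersecting \<W>)"
  shows "3 * card \<V> \<le> 2 * card (subspaces_of_dim n k :: (nat \<Rightarrow> 'a) set set)
    + 3 * d * card (UNIV :: 'a set) ^ (2 * n)"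
proof (rule ccontr)
  assume big: "\<not> ?thesis"
  let ?Sub = "subspaces_of_dim n k :: (nat \<Rightarrow> 'a) set set"
  let ?S = "coord_space n :: (nat \<Rightarrow> 'a) set"
  let ?q = "card (UNIV :: 'a set)"
  \<comment> \<open>Degrees are measured in \<open>\<V>\<close> and not in
    \<open>\<V> - \<L>\<close>, so one deletion suffices: the members added later may themselves lie
    in \<open>\<L>\<close>.\<close>
  define \<L> where "\<L> = {F \<in> \<V>. \<exists>a\<in>F. \<exists>b\<in>F. card {G \<in> \<V>. a \<in> G \<and> b \<in> G} < d - 1}"
  have fin: "finite ?Sub" "finite \<V>"
    using \<V> finite_subspaces_of_dim finite_subset by blast+
  have "card \<L> \<le> card ?S ^ 2 * (d - 1)"
    unfolding \<L>_def using \<V> fin by (intro card_light_members_le) (auto simp: card_coord_space subspaces_of_dim_def)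
  also have "card ?S ^ 2 = ?q ^ (2 * n)"
    by (simp add: card_coord_space power_mult mult.commute)
  finally have L: "card \<L> \<le> ?q ^ (2 * n) * d"
    by (meson diff_le_self le_trans mult_le_mono2)
  have "\<L> \<subseteq> \<V>" by (auto simp: \<L>_def)
  then have "card (?Sub - (\<V> - \<L>)) = card ?Sub - (card \<V> - card \<L>)"
    using fin \<V> by (subst card_Diff_subset) (auto simp: card_Diff_subset finite_subset)
  moreover have "card \<V> \<le> card ?Sub" "card \<L> \<le> card \<V>"
    using fin \<V> \<open>\<L> \<subseteq> \<V>\<close> by (auto intro: card_mono)
  moreover have "card \<V> * 3 > card ?Sub * 2 + 3 * (?q ^ (2 * n) * d)"
    using big by (simp add: mult_ac)
  ultimately have less: "3 * card (?Sub - (\<V> - \<L>)) < card ?Sub"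
    using L by linarith
  \<comment> \<open>Three rotations enter the union bound, hence the requirement that fewer than a
    third of all \<open>k\<close>-spaces be missing.\<close>
  have "card {0, 1, k} = 3" using \<open>k \<ge> 2\<close> by simp
  then have "\<exists>xs \<in> coord.indep_lists ?S (k + (k - 1)).
      \<forall>j\<in>{0, 1, k}. coord.span (set (drop (k - 1) (rotate j xs))) \<in> \<V> - \<L>"
    using less \<V> \<open>2 * k - 1 \<le> n\<close> \<open>k \<ge> 2\<close> by (intro exists_indep_list_rotations_in) auto
  then obtain xs where xs: "xs \<in> coord.indep_lists ?S (k + (k - 1))"
    "\<And>j. j \<in> {0, 1, k} \<Longrightarrow> coord.span (set (drop (k - 1) (rotate j xs))) \<in> \<V> - \<L>"
    by blast
  have "\<exists>\<W>\<subseteq>\<V>. card \<W> = d + 1 \<and> nontrivial_intersecting \<W>"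
  proof (rule nontrivial_intersecting_from_list[OF \<V> \<open>k \<ge> 2\<close> \<open>d \<ge> 2\<close> xs(1)])
    fix a b
    assume "a \<in> coord.span (set (drop (k - 1) (rotate k xs)))" "b \<in> coord.span (set (drop (k - 1) (rotate k xs)))"
    moreover have "coord.span (set (drop (k - 1) (rotate k xs))) \<in> \<V> - \<L>"
      by (rule xs(2)) simp
    ultimately show "d - 1 \<le> card {G \<in> \<V>. a \<in> G \<and> b \<in> G}"
      unfolding \<L>_def using linorder_not_less by blast
  qed (use xs(2) in blast)
  with no show False by blast
qed

section \<open>Numerical comparison for large \<open>n\<close>\<close>

theorem theorem4p5:
  fixes q d k :: nat
  assumes "primepow q"
    and "card (UNIV :: 'a::{field,finite} set) = q"
    and "d \<ge> k" and "k \<ge> 4"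
  shows "\<exists>N. \<forall>n\<ge>N. \<forall>\<V>::(nat \<Rightarrow> 'a) set set.
    \<V> \<subseteq> subspaces_of_dim n k \<longrightarrow>
    \<not> (\<exists>\<W>\<subseteq>\<V>. card \<W> = d + 1 \<and> nontrivial_intersecting \<W>) \<longrightarrow>
      real (card \<V>) \<le> real q ^ (n - k) * gauss_binomial q (n - 1) (k - 1) \<and>
      real q ^ (n - k) * gauss_binomial q (n - 1) (k - 1)
        = gauss_binomial q n k - gauss_binomial q (n - 1) k"
proof (intro exI[of _ "k * k + 8 * d"] allI impI)
  \<comment> \<open>In the threshold, \<open>8 * d \<le> n\<close> gives
    \<open>8 * d \<le> q ^ n\<close>, and \<open>k * k \<le> n\<close> with \<open>k \<ge> 4\<close>
    gives \<open>k * (n - k) \<ge> 4 * n - n = 3 * n\<close>. Together they make the error term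
    \<open>d * q ^ (2 * n)\<close> at most an eighth of \<open>G\<close>.\<close>
  fix n :: nat and \<V> :: "(nat \<Rightarrow> 'a) set set"
  assume n: "k * k + 8 * d \<le> n" and \<V>: "\<V> \<subseteq> subspaces_of_dim n k"
    and no: "\<not> (\<exists>\<W>\<subseteq>\<V>. card \<W> = d + 1 \<and> nontrivial_intersecting \<W>)"
  have q2: "q \<ge> 2"
    using card_mono[of UNIV "{0, 1 :: 'a}"] assms(2) by simp
  have kn: "2 * k \<le> n" "1 \<le> k" "k < n" using n \<open>d \<ge> k\<close> \<open>k \<ge> 4\<close> by auto
  define G where "G = gauss_binomial q n k"
  have "3 * real (card \<V>) \<le> 2 * G + 3 * (d * real q ^ (2 * n))"
  proof -
    have "3 * card \<V> \<le> 2 * card (subspaces_of_dim n k :: (nat \<Rightarrow> 'a) set set) + 3 * d * q ^ (2 * n)"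
      using card_le_if_no_nontrivial_intersecting[OF \<V> _ _ _ no] assms kn by auto
    then have "real (3 * card \<V>) \<le>
        real (2 * card (subspaces_of_dim n k :: (nat \<Rightarrow> 'a) set set) + 3 * d * q ^ (2 * n))"
      by (rule of_nat_mono)
    then show ?thesis
      using card_subspaces_of_dim[OF assms(2), of k n] kn by (simp add: G_def)
  qed
  moreover have "8 * (d * real q ^ (2 * n)) \<le> G"
  proof -
    have "8 * d \<le> q ^ n"
      using n q2 less_exp[of n] power_mono[of 2 q n] by linarith
    have "k * (n - k) + k * k = k * n"
      using kn by (simp flip: distrib_left)
    moreover have "4 * n \<le> k * n" using \<open>k \<ge> 4\<close> by simp
    ultimately have "n + 2 * n \<le> k * (n - k)"
      using n by linarith
    have "8 * (d * real q ^ (2 * n)) = real (8 * d) * real q ^ (2 * n)" by simp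
    also have "\<dots> \<le> real q ^ n * real q ^ (2 * n)"
      using \<open>8 * d \<le> q ^ n\<close> by (intro mult_right_mono) (simp_all flip: of_nat_power)
    also have "\<dots> \<le> real q ^ (k * (n - k))"
      using \<open>n + 2 * n \<le> k * (n - k)\<close> q2 by (auto simp flip: power_add intro!: power_increasing)
    also have "\<dots> \<le> G"
      unfolding G_def using q2 kn by (intro gauss_binomial_ge_power) auto
    finally show ?thesis .
  qed
  moreover have "16 * gauss_binomial q (n - 1) k \<le> G"
  proof -
    have "(2::real) ^ 4 \<le> 2 ^ k" using \<open>k \<ge> 4\<close> by (intro power_increasing) auto
    also have "\<dots> \<le> real q ^ k" using q2 by (intro power_mono) auto
    finally have "16 * gauss_binomial q (n - 1) k \<le> real q ^ k * gauss_binomial q (n - 1) k"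
      using card_subspaces_of_dim[OF assms(2), of k "n - 1"] kn
      by (intro mult_right_mono) (auto simp flip: card_subspaces_of_dim[OF assms(2)])
    then show ?thesis
      using gauss_binomial_pred_left_le[OF q2, of k n] kn by (simp add: G_def)
  qed
  moreover have "real q ^ (n - k) * gauss_binomial q (n - 1) (k - 1) = G - gauss_binomial q (n - 1) k"
    unfolding G_def using q2 kn by (intro gauss_binomial_pascal)
  moreover have "G \<ge> 0"
    using card_subspaces_of_dim[OF assms(2), of k n] kn by (simp add: G_def flip: card_subspaces_of_dim[OF assms(2)])
  \<comment> \<open>The three estimates give
    \<open>card \<V> \<le> (2/3 + 1/8) * G = 19/24 * G\<close>, which is at most
    \<open>15/16 * G\<close> and hence at most
    \<open>G - gauss_binomial q (n - 1) k\<close>.\<close>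
  ultimately show "real (card \<V>) \<le> real q ^ (n - k) * gauss_binomial q (n - 1) (k - 1) \<and>
      real q ^ (n - k) * gauss_binomial q (n - 1) (k - 1)
        = gauss_binomial q n k - gauss_binomial q (n - 1) k"
    by (simp add: G_def)
qed

end
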